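(* Let $U\subseteq R_{2,1}$ be a four-dimensional subspace. If $I_U$ has a linear first syzygy of bidegree $(0,1)$, then \[I_U=\langle pu,pv,p_2,p_3\rangle\] for some $p$ homogeneous of bidegree $(2,0)$ and some $p_2,p_3\in R_{2,1}$.
   Context: $k$ is an algebraically closed field and $R=k[s,t,u,v]$ is bigraded with $s,t$ of degree $(1,0)$ and $u,v$ of degree $(0,1)$; $R_{m,n}$ is the graded piece of bidegree $(m,n)$. For a four-dimensional subspace $U=\mathrm{Span}\{p_0,p_1,p_2,p_3\}\subseteq R_{2,1}$, $I_U=\langle p_0,p_1,p_2,p_3\rangle\subset R$. (The conclusion allows a new choice of generators.) A first syzygy of bidegree $(a,b)$ on $I_U$ is a nonzero tuple $(g_0,\dots,g_3)\in R_{a,b}^4$ with $\sum g_ip_i=0$. *)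

theory Defs
  imports
    "HOL-Library.Poly_Mapping"
    "HOL-Computational_Algebra.Computational_Algebra"
begin

datatype var = Vs | Vt | Vu | Vv

text \<open>The ring k[s,t,u,v]: finitely supported functions from monomials (exponent vectors) to
  coefficients, with the convolution product of \<^theory>\<open>HOL-Library.Poly_Mapping\<close>.\<close>

type_synonym 'k R = "(var \<Rightarrow>\<^sub>0 nat) \<Rightarrow>\<^sub>0 'k"

definition Var :: "var \<Rightarrow> 'k::field R"
  where "Var x = Poly_Mapping.single (Poly_Mapping.single x 1) 1"

definition scale :: "'k::field \<Rightarrow> 'k R \<Rightarrow> 'k R"
  where "scale c f = Poly_Mapping.single 0 c * f"

interpretation R: vector_space scale
  by unfold_locales
    (simp_all add: scale_def distrib_left distrib_right single_add mult_single
      flip: mult.assoc)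

interpretation R_mod: module "(*) :: 'k::field R \<Rightarrow> 'k R \<Rightarrow> 'k R"
  by unfold_locales (simp_all add: algebra_simps)

text \<open>An ideal of R is an R-submodule of R, so the ideal generated by a set is its span over R.\<close>

abbreviation ideal_gen :: "'k::field R set \<Rightarrow> 'k R set"
  where "ideal_gen S \<equiv> R_mod.span S"

text \<open>The graded piece of bidegree (m,n); like every graded piece it contains 0.\<close>

definition piece :: "nat \<Rightarrow> nat \<Rightarrow> 'k::field R set"
  where "piece m n = {f. \<forall>e \<in> Poly_Mapping.keys f.
    Poly_Mapping.lookup e Vs + Poly_Mapping.lookup e Vt = m \<and> Poly_Mapping.lookup e Vu + Poly_Mapping.lookup e Vv = n}"

definition is_syzygy :: "nat \<Rightarrow> nat \<Rightarrow> (nat \<Rightarrow> 'k::field R) \<Rightarrow> (nat \<Rightarrow> 'k R) \<Rightarrow> bool"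
  where "is_syzygy a b p g \<longleftrightarrow>
    (\<forall>i<4. g i \<in> piece a b) \<and> (\<exists>i<4. g i \<noteq> 0) \<and> (\<Sum>i<4. g i * p i) = 0"

end

theory Submission
  imports Defs
begin

text \<open>
  Sort the coefficients \<open>g\<^sub>i = a\<^sub>i u + b\<^sub>i v\<close> of the syzygy by variable: with
  \<open>P = \<Sum> a\<^sub>i p\<^sub>i\<close> and \<open>Q = \<Sum> b\<^sub>i p\<^sub>i\<close> in \<open>U\<close> it reads \<open>u P + v Q = 0\<close>, so
  \<open>P = q v\<close> and \<open>Q = - q u\<close> for some \<open>q\<close>. Since the \<open>p\<^sub>i\<close> are independent and the syzygy is
  nonzero, \<open>q\<close> is nonzero. Hence \<open>q u\<close> and \<open>q v\<close> are independent elements of \<open>U\<close>, and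
  any extension of them to a basis of \<open>U\<close> generates the ideal.
\<close>

text \<open>In the convolution only the summand at \<open>a\<close> survives, and cancellation in
  the exponent monoid then leaves exactly one complementary exponent, \<open>k\<close>.\<close>

lemma lookup_single_mult_add:
  fixes f :: "'a::cancel_comm_monoid_add \<Rightarrow>\<^sub>0 'b::semiring_0"
  shows "Poly_Mapping.lookup (Poly_Mapping.single a c * f) (a + k) = c * Poly_Mapping.lookup f k"
proof -
  have "Poly_Mapping.lookup (Poly_Mapping.single a c * f) (a + k) =
      (\<Sum>l. (c * (\<Sum>q. (Poly_Mapping.lookup f q when a + k = l + q)) when l = a))"
    unfolding lookup_mult lookup_single by (rule Sum_any.cong) (auto simp: when_def)
  then show ?thesis by simp
qed

lemma lookup_scale: "Poly_Mapping.lookup (scale c f) k = c * Poly_Mapping.lookup f k"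
  using lookup_single_mult_add[of 0 c f k] by (simp add: scale_def)

lemma mult_scale: "f * scale c g = scale c f * g"
  unfolding scale_def by (simp only: mult_ac)

lemma lookup_Var_mult_add:
  "Poly_Mapping.lookup (Var x * f) (Poly_Mapping.single x 1 + k) = Poly_Mapping.lookup f k"
  by (simp add: Var_def lookup_single_mult_add)

lemma lookup_Var_mult_eq_0:
  assumes "Poly_Mapping.lookup k x = 0"
  shows "Poly_Mapping.lookup (Var x * f) k = 0"
proof (rule ccontr)
  assume "Poly_Mapping.lookup (Var x * f) k \<noteq> 0"
  then have "k \<in> Poly_Mapping.keys (Var x * f)" by (simp add: in_keys_iff)
  then have "\<exists>l. k = Poly_Mapping.single x 1 + l"
    using keys_mult[of "Var x" f] by (auto simp: Var_def)
  with assms show False by (auto simp: lookup_add)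
qed

lemma Var_mult_eq_0_iff: "Var x * f = 0 \<longleftrightarrow> f = 0"
proof
  assume "Var x * f = 0"
  then show "f = 0"
    using lookup_Var_mult_add[of x f] by (intro poly_mapping_eqI) simp
qed simp

lemma Var_dvd_if_keys:
  assumes "\<And>k. k \<in> Poly_Mapping.keys f \<Longrightarrow> Poly_Mapping.lookup k x \<noteq> 0"
  shows "Var x dvd f"
proof
  \<comment> \<open>The quotient is \<open>f\<close> with every exponent of \<open>x\<close> lowered
    by one. \<open>map_key\<close> achieves this by precomposing the coefficient function with the
    injective shift \<open>?s\<close>.\<close>
  let ?s = "\<lambda>k. Poly_Mapping.single x (1::nat) + k"
  show "f = Var x * Poly_Mapping.map_key ?s f"
  proof (rule poly_mapping_eqI)
    fix k
    show "Poly_Mapping.lookup f k = Poly_Mapping.lookup (Var x * Poly_Mapping.map_key ?s f) k"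
    proof (cases "Poly_Mapping.lookup k x = 0")
      case True
      then show ?thesis
        using assms[of k] by (auto simp: lookup_Var_mult_eq_0 in_keys_iff)
    next
      case False
      \<comment> \<open>Subtraction of exponents is truncated; it is exact here because
        \<open>x\<close> occurs in \<open>k\<close>.\<close>
      then have "k = ?s (k - Poly_Mapping.single x 1)"
        by (intro poly_mapping_eqI) (auto simp: lookup_add lookup_minus lookup_single when_def)
      then obtain l where k: "k = ?s l" by blast
      show ?thesis
        unfolding k lookup_Var_mult_add by (subst map_key.rep_eq) (auto intro: injI)
    qed
  qed
qed

text \<open>A monomial of \<open>P\<close> free of \<open>y\<close> would give a monomial of
  \<open>Var x * P\<close> free of \<open>y\<close>, which no term of \<open>Var y * Q\<close> can
  cancel. So \<open>Var y\<close> divides \<open>P\<close>, and cancelling \<open>Var y\<close> from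
  the relation determines \<open>Q\<close>.\<close>

lemma Koszul_syzygy:
  assumes "x \<noteq> y" and "Var x * P + Var y * Q = 0"
  obtains q where "P = q * Var y" and "Q = - (q * Var x)"
proof -
  have "Var y dvd P"
  proof (rule Var_dvd_if_keys, rule notI)
    fix k
    assume k: "k \<in> Poly_Mapping.keys P" and "Poly_Mapping.lookup k y = 0"
    then have "Poly_Mapping.lookup (Var y * Q) (Poly_Mapping.single x 1 + k) = 0"
      using assms(1) by (intro lookup_Var_mult_eq_0) (simp add: lookup_add lookup_single)
    moreover have "Poly_Mapping.lookup (Var x * P + Var y * Q) (Poly_Mapping.single x 1 + k) = 0"
      by (simp only: assms(2) lookup_zero)
    ultimately have "Poly_Mapping.lookup P k = 0"
      unfolding lookup_add lookup_Var_mult_add by simp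
    with k show False by (simp add: in_keys_iff)
  qed
  then obtain q where q: "P = Var y * q" ..
  have "Var y * (Q + q * Var x) = Var x * P + Var y * Q"
    unfolding q distrib_left by (simp only: ac_simps)
  then have "Var y * (Q + q * Var x) = 0"
    by (simp only: assms(2))
  then have "Q = - (q * Var x)"
    by (simp only: Var_mult_eq_0_iff eq_neg_iff_add_eq_0)
  with q show ?thesis by (intro that) (simp_all only: mult.commute)
qed

lemma piece_mult_Var_vD:
  assumes "q * Var Vv \<in> piece m (Suc n)"
  shows "q \<in> piece m n"
  unfolding piece_def
proof (intro CollectI ballI)
  fix k
  assume "k \<in> Poly_Mapping.keys q"
  then have "Poly_Mapping.single Vv 1 + k \<in> Poly_Mapping.keys (q * Var Vv)"
    unfolding in_keys_iff mult.commute[of q] lookup_Var_mult_add .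
  with assms have "Poly_Mapping.lookup (Poly_Mapping.single Vv 1 + k) Vs
        + Poly_Mapping.lookup (Poly_Mapping.single Vv 1 + k) Vt = m \<and>
      Poly_Mapping.lookup (Poly_Mapping.single Vv 1 + k) Vu
        + Poly_Mapping.lookup (Poly_Mapping.single Vv 1 + k) Vv = Suc n"
    unfolding piece_def by blast
  then show "Poly_Mapping.lookup k Vs + Poly_Mapping.lookup k Vt = m \<and>
      Poly_Mapping.lookup k Vu + Poly_Mapping.lookup k Vv = n"
    by (simp add: lookup_add lookup_single)
qed

lemma piece_0_1E:
  assumes "g \<in> piece 0 1"
  obtains a b where "g = scale a (Var Vu) + scale b (Var Vv)"
proof
  let ?u = "Poly_Mapping.single Vu (1::nat)" and ?v = "Poly_Mapping.single Vv (1::nat)"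
  have neq: "?u \<noteq> ?v"
    by (metis lookup_single_eq lookup_single_not_eq one_neq_zero var.distinct(11))
  show "g = scale (Poly_Mapping.lookup g ?u) (Var Vu) + scale (Poly_Mapping.lookup g ?v) (Var Vv)"
  proof (rule poly_mapping_eqI)
    fix k
    have "k = ?u \<or> k = ?v" if "k \<in> Poly_Mapping.keys g"
    proof -
      have k: "Poly_Mapping.lookup k Vs = 0" "Poly_Mapping.lookup k Vt = 0"
        "Poly_Mapping.lookup k Vu + Poly_Mapping.lookup k Vv = 1"
        using assms that by (auto simp: piece_def)
      then consider "Poly_Mapping.lookup k Vu = 1" "Poly_Mapping.lookup k Vv = 0"
        | "Poly_Mapping.lookup k Vu = 0" "Poly_Mapping.lookup k Vv = 1"
        by linarith
      then show ?thesis
      proof cases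
        case 1
        have "k = ?u"
        proof (rule poly_mapping_eqI)
          fix x show "Poly_Mapping.lookup k x = Poly_Mapping.lookup ?u x"
            using k 1 by (cases x) (simp_all add: lookup_single)
        qed
        then show ?thesis ..
      next
        case 2
        have "k = ?v"
        proof (rule poly_mapping_eqI)
          fix x show "Poly_Mapping.lookup k x = Poly_Mapping.lookup ?v x"
            using k 2 by (cases x) (simp_all add: lookup_single)
        qed
        then show ?thesis ..
      qed
    qed
    then show "Poly_Mapping.lookup g k = Poly_Mapping.lookup
        (scale (Poly_Mapping.lookup g ?u) (Var Vu) + scale (Poly_Mapping.lookup g ?v) (Var Vv)) k"
      using neq
      by (cases "k \<in> Poly_Mapping.keys g")
        (auto simp: lookup_add lookup_scale Var_def lookup_single when_def in_keys_iff)
  qed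
qed

text \<open>The monomial \<open>k\<close> times \<open>x\<close> separates the two products: it
  occurs in \<open>q * Var x\<close>, but it contains no \<open>y\<close> and so occurs in no scalar
  multiple of \<open>q * Var y\<close>.\<close>

lemma independent_mult_Vars:
  assumes "x \<noteq> y" and "k \<in> Poly_Mapping.keys q" and "Poly_Mapping.lookup k y = 0"
  shows "R.independent {q * Var x, q * Var y}" and "q * Var x \<noteq> q * Var y"
proof -
  have nz: "Poly_Mapping.lookup (q * Var x) (Poly_Mapping.single x 1 + k) \<noteq> 0"
    using assms(2) by (simp only: mult.commute[of q] lookup_Var_mult_add in_keys_iff not_False_eq_True)
  have z: "Poly_Mapping.lookup (q * Var y) (Poly_Mapping.single x 1 + k) = 0"
    unfolding mult.commute[of q]
    using assms(1,3) by (intro lookup_Var_mult_eq_0) (simp add: lookup_add lookup_single)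
  show neq: "q * Var x \<noteq> q * Var y" using nz z by metis
  have "q \<noteq> 0" using assms(2) by auto
  then have "q * Var y \<noteq> 0"
    by (simp add: mult.commute[of q] Var_mult_eq_0_iff)
  moreover have "q * Var x \<notin> R.span {q * Var y}"
    using nz z by (auto simp: R.span_singleton lookup_scale)
  ultimately show "R.independent {q * Var x, q * Var y}"
    using neq by (simp add: R.independent_insert)
qed

text \<open>A basis chosen among the \<open>n\<close> listed vectors has \<open>n\<close> elements,
  so it is the whole list. Hence the list has no repetitions and is independent.\<close>

lemma (in vector_space) sum_scale_eq_0_if_dim_eq:
  assumes "dim (span (p ` {..<n})) = n" and "(\<Sum>i<n. scale (a i) (p i)) = 0" and "i < n"
  shows "a i = 0"
proof -
  obtain B where B: "B \<subseteq> p ` {..<n}" "independent B" "p ` {..<n} \<subseteq> span B"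
    using maximal_independent_subset by blast
  then have "card B = n"
    using assms(1) basis_card_eq_dim[of B "p ` {..<n}"] by simp
  moreover have "card (p ` {..<n}) \<le> n"
    using card_image_le[of "{..<n}" p] by simp
  ultimately have "B = p ` {..<n}"
    using B(1) by (intro card_seteq) auto
  then have ind: "independent (p ` {..<n})" and "card (p ` {..<n}) = card {..<n}"
    using B(2) \<open>card B = n\<close> by auto
  then have inj: "inj_on p {..<n}" by (intro eq_card_imp_inj_on) auto
  \<comment> \<open>Independence concerns sets, so the coefficients are transported from indices to
    vectors along the inverse of \<open>p\<close>.\<close>
  have "(\<Sum>x\<in>p ` {..<n}. scale (a (the_inv_into {..<n} p x)) x) = 0"
    using assms(2) inj by (simp add: sum.reindex the_inv_into_f_f)
  then have "a (the_inv_into {..<n} p (p i)) = 0"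
    using independentD[OF ind, of "p ` {..<n}" "\<lambda>x. a (the_inv_into {..<n} p x)" "p i"] assms(3)
    by simp
  then show ?thesis using inj assms(3) by (simp add: the_inv_into_f_f)
qed

text \<open>An ideal is closed under scalars, hence contains the linear span of its generators. This
  allows the basis of \<open>U\<close> to be changed without changing the ideal.\<close>

lemma ideal_gen_cong_span:
  assumes "R.span S = R.span T"
  shows "ideal_gen S = ideal_gen T"
proof -
  have "R.span A \<subseteq> ideal_gen A" for A :: "'a R set"
  proof (rule R.span_minimal)
    show "R.subspace (ideal_gen A)"
      by (auto simp: R.subspace_def scale_def
          intro: R_mod.span_zero R_mod.span_add R_mod.span_scale)
  qed (rule R_mod.span_superset)
  then show ?thesis
    using assms R.span_superset[of S] R.span_superset[of T] by (simp add: R_mod.span_eq) blast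
qed

theorem lemma3p1:
  fixes U :: "'k::alg_closed_field R set" and p :: "nat \<Rightarrow> 'k R"
  assumes "R.subspace U" and "U \<subseteq> piece 2 1" and "R.dim U = 4"
    and "U = R.span (p ` {..<4})"
    and "\<exists>g. is_syzygy 0 1 p g"
  shows "\<exists>q \<in> piece 2 0. \<exists>p2 \<in> piece 2 1. \<exists>p3 \<in> piece 2 1.
    ideal_gen (p ` {..<4}) = ideal_gen {q * Var Vu, q * Var Vv, p2, p3}"
proof -
  obtain g where g: "\<And>i. i < 4 \<Longrightarrow> g i \<in> piece 0 1" "\<exists>i<4. g i \<noteq> 0" "(\<Sum>i<4. g i * p i) = 0"
    using assms(5) by (auto simp: is_syzygy_def)
  \<comment> \<open>The bound on \<open>i\<close> sits inside the existential so that
    \<open>choice\<close> yields total coefficient functions.\<close>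
  have "\<forall>i. \<exists>a b. i < 4 \<longrightarrow> g i = scale a (Var Vu) + scale b (Var Vv)"
    by (meson g(1) piece_0_1E)
  from choice[OF this] obtain a
    where "\<forall>i. \<exists>b. i < 4 \<longrightarrow> g i = scale (a i) (Var Vu) + scale b (Var Vv)" ..
  from choice[OF this] obtain b
    where ab: "\<forall>i. i < 4 \<longrightarrow> g i = scale (a i) (Var Vu) + scale (b i) (Var Vv)" ..
  define P where "P = (\<Sum>i<4. scale (a i) (p i))"
  define Q where "Q = (\<Sum>i<4. scale (b i) (p i))"
  have summand: "Var Vu * scale (a i) (p i) + Var Vv * scale (b i) (p i) = g i * p i" if "i < 4" for i
    using ab that by (simp only: mult_scale distrib_right)
  have "Var Vu * P + Var Vv * Q =
      (\<Sum>i<4. Var Vu * scale (a i) (p i) + Var Vv * scale (b i) (p i))"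
    by (simp only: P_def Q_def sum_distrib_left sum.distrib)
  also have "\<dots> = (\<Sum>i<4. g i * p i)"
    by (rule sum.cong) (simp_all only: summand lessThan_iff)
  also note g(3)
  finally obtain q where q: "P = q * Var Vv" "Q = - (q * Var Vu)"
    by (rule Koszul_syzygy[rotated]) blast+
  have PQ: "P \<in> U" "Q \<in> U"
    unfolding P_def Q_def assms(4) by (intro R.span_sum R.span_scale R.span_base imageI; assumption)+
  have qu: "q * Var Vu \<in> U" and qv: "q * Var Vv \<in> U"
    using PQ q R.subspace_neg[OF assms(1) PQ(2)] by auto
  have q20: "q \<in> piece 2 0"
    by (rule piece_mult_Var_vD) (use qv assms(2) in auto)
  have "q \<noteq> 0"
  proof
    assume "q = 0"
    then have "P = 0" "Q = 0" using q by auto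
    then have "a i = 0 \<and> b i = 0" if "i < 4" for i
      using R.sum_scale_eq_0_if_dim_eq[of p 4 a i] R.sum_scale_eq_0_if_dim_eq[of p 4 b i]
        assms(3,4) that by (simp add: P_def Q_def)
    then show False using g(2) ab by auto
  qed
  then obtain k where k: "k \<in> Poly_Mapping.keys q"
    by (metis all_not_in_conv keys_eq_empty)
  \<comment> \<open>Bidegree (2,0) excludes \<open>v\<close> from every monomial of
    \<open>q\<close>, so any \<open>k\<close> can serve as the separating monomial.\<close>
  with q20 have "Poly_Mapping.lookup k Vv = 0" by (auto simp: piece_def)
  with k have ind: "R.independent {q * Var Vu, q * Var Vv}" "q * Var Vu \<noteq> q * Var Vv"
    using independent_mult_Vars[of Vu Vv k q] by auto
  obtain B where B: "{q * Var Vu, q * Var Vv} \<subseteq> B" "B \<subseteq> U" "R.independent B" "U \<subseteq> R.span B"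
    using R.maximal_independent_subset_extend[of "{q * Var Vu, q * Var Vv}" U] qu qv ind(1) by auto
  then have "card B = 4"
    using assms(3) R.basis_card_eq_dim[of B U] by simp
  \<comment> \<open>The two products are distinct, so removing them from the four basis vectors
    leaves exactly two, which become \<open>p2\<close> and \<open>p3\<close>.\<close>
  then have "card (B - {q * Var Vu, q * Var Vv}) = 2"
    using B(1) ind(2) by (simp add: card_Diff_subset)
  then obtain p2 p3 where p23: "B - {q * Var Vu, q * Var Vv} = {p2, p3}"
    by (auto simp: card_2_iff)
  then have Beq: "B = {q * Var Vu, q * Var Vv, p2, p3}" using B(1) by auto
  have "R.span (p ` {..<4}) = R.span B"
    using B assms(1,4) R.span_subspace by metis
  then have "ideal_gen (p ` {..<4}) = ideal_gen {q * Var Vu, q * Var Vv, p2, p3}"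
    unfolding Beq by (rule ideal_gen_cong_span)
  moreover have "p2 \<in> piece 2 1" "p3 \<in> piece 2 1"
    using B(2) assms(2) by (auto simp: Beq)
  ultimately show ?thesis using q20 by blast
qed

end
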